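(* There is an absolute constant $C>0$ such that the following holds. Let $P$ be a set of $n$ points in the plane in general position, and let $d$ be the twin-width of $P$. Then $\mathrm{OPT}(P) \le C\, n d^2$, i.e. $\mathrm{OPT}(P)\in\mathcal{O}(nd^2)$.
   Context: A finite point set in the plane is in general position if no two of its points share an $x$-coordinate or a $y$-coordinate. A point set $S$ is (arborally) satisfied if for any two points $p,q\in S$, either $p$ and $q$ share an $x$- or $y$-coordinate, or the closed axis-parallel rectangle with corners $p$ and $q$ contains a point of $S\setminus\{p,q\}$ (possibly on its boundary). $\mathrm{OPT}(P)$ denotes the minimum size of a satisfied set $S\supseteq P$. Twin-width: a rectangle family is a set of axis-parallel rectangles (single points count as degenerate rectangles). Merging two rectangles $S,T$ of a family replaces them by their bounding box (smallest axis-parallel rectangle containing $S\cup T$). A merge sequence of an $n$-point set $P$ is a sequence of rectangle families $\mathscr{R}_1,\dots,\mathscr{R}_n$ with $\mathscr{R}_1=P$, $\mathscr{R}_n$ a single rectangle, and each $\mathscr{R}_{i+1}$ obtained from $\mathscr{R}_i$ by merging two of its rectangles. Two rectangles are homogeneous if their projections onto the $x$-axis are disjoint and their projections onto the $y$-axis are disjoint. The red graph of $\mathscr{R}_i$ has the rectangles of $\mathscr{R}_i$ as vertices and an edge between every two distinct non-homogeneous rectangles. A merge sequence is $d$-wide if every red graph of the sequence has maximum degree strictly less than $d$. The twin-width of $P$ is the minimum $d$ such that $P$ has a $d$-wide merge sequence. *)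

theory Defs
  imports Complex_Main
begin

type_synonym point = "real \<times> real"

definition general_position :: "point set \<Rightarrow> bool" where
  "general_position P \<longleftrightarrow>
     (\<forall>p\<in>P. \<forall>q\<in>P. p \<noteq> q \<longrightarrow> fst p \<noteq> fst q \<and> snd p \<noteq> snd q)"

definition corner_rect :: "point \<Rightarrow> point \<Rightarrow> point set" where
  "corner_rect p q =
     {min (fst p) (fst q)..max (fst p) (fst q)} \<times> {min (snd p) (snd q)..max (snd p) (snd q)}"

definition satisfied :: "point set \<Rightarrow> bool" where
  "satisfied S \<longleftrightarrow>
     (\<forall>p\<in>S. \<forall>q\<in>S. fst p = fst q \<or> snd p = snd q \<or> corner_rect p q \<inter> (S - {p, q}) \<noteq> {})"

definition OPT :: "point set \<Rightarrow> nat" where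
  "OPT P = (LEAST k. \<exists>S. finite S \<and> P \<subseteq> S \<and> satisfied S \<and> card S = k)"

definition rectangle :: "point set \<Rightarrow> bool" where
  "rectangle R \<longleftrightarrow> (\<exists>a b c d. a \<le> b \<and> c \<le> d \<and> R = {a..b} \<times> {c..d})"

definition bounding_box :: "point set \<Rightarrow> point set" where
  "bounding_box X = rectangle hull X"

definition homogeneous :: "point set \<Rightarrow> point set \<Rightarrow> bool" where
  "homogeneous S T \<longleftrightarrow> fst ` S \<inter> fst ` T = {} \<and> snd ` S \<inter> snd ` T = {}"

definition red_edges :: "point set set \<Rightarrow> point set set set" where
  "red_edges \<R> = {{S, T} | S T. S \<in> \<R> \<and> T \<in> \<R> \<and> S \<noteq> T \<and> \<not> homogeneous S T}"

definition max_degree :: "'v set \<Rightarrow> 'v set set \<Rightarrow> nat" where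
  "max_degree V E = Max ((\<lambda>v. card {e \<in> E. v \<in> e}) ` V)"

definition merge_step :: "point set set \<Rightarrow> point set set \<Rightarrow> bool" where
  "merge_step \<R> \<R>' \<longleftrightarrow>
     (\<exists>S\<in>\<R>. \<exists>T\<in>\<R>. S \<noteq> T \<and> \<R>' = insert (bounding_box (S \<union> T)) (\<R> - {S, T}))"

text \<open>
  Families are indexed from 1 to \<open>card P\<close>; the values of the function elsewhere are irrelevant.
  Plain sets of rectangles suffice: for \<open>P\<close> in general position, the rectangles
  of a family are bounding boxes of disjoint parts of \<open>P\<close>, hence pairwise distinct, so a
  merge always decreases the number of rectangles by exactly one.
\<close>
definition merge_sequence :: "point set \<Rightarrow> (nat \<Rightarrow> point set set) \<Rightarrow> bool" where
  "merge_sequence P \<R> \<longleftrightarrow>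
     \<R> 1 = (\<lambda>p. {p}) ` P \<and>
     (\<exists>S. \<R> (card P) = {S}) \<and>
     (\<forall>i\<in>{1..<card P}. merge_step (\<R> i) (\<R> (Suc i)))"

text \<open>The bound on the degree is strict, so a nonempty point set has twin-width at least 1.\<close>
definition wide :: "nat \<Rightarrow> point set \<Rightarrow> (nat \<Rightarrow> point set set) \<Rightarrow> bool" where
  "wide d P \<R> \<longleftrightarrow> (\<forall>i\<in>{1..card P}. max_degree (\<R> i) (red_edges (\<R> i)) < d)"

definition twin_width :: "point set \<Rightarrow> nat" where
  "twin_width P = (LEAST d. \<exists>\<R>. merge_sequence P \<R> \<and> wide d P \<R>)"

end

theory Submission
  imports Defs
begin

text \<open>
  For a merge sequence \<open>F 1, \<dots>, F n\<close>, let \<open>grid (F i)\<close> be the product of the sets of all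
  \<open>x\<close>-coordinates of vertical sides and all \<open>y\<close>-coordinates of horizontal sides of rectangles
  of \<open>F i\<close>; these grids decrease with \<open>i\<close>. Layer \<open>i\<close> consists of the points of \<open>grid (F i)\<close>
  that are covered by \<open>F (i + 1)\<close>, and the satisfied superset is the union of the layers.

  Size: a point of layer \<open>i\<close> that is not in layer \<open>i - 1\<close> lies in the rectangle \<open>Q\<close> created at
  step \<open>i\<close>, and its coordinates come from the two merged rectangles or from rectangles that are
  red neighbours of \<open>Q\<close>, because their projections meet those of \<open>Q\<close>. This leaves at most
  \<open>2 (d + 1)\<close> values for either coordinate.

  Satisfaction: suppose no third point lies in the box of \<open>p\<close> and \<open>q\<close>. If a rectangle
  contains \<open>p\<close> and misses both coordinates of \<open>q\<close>, then its corner nearest to \<open>q\<close> must be \<open>p\<close>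
  itself, so \<open>p\<close> survives in its grid; this reduces to the case where \<open>p\<close> and \<open>q\<close> share a
  layer. In the last common layer the rectangles around \<open>p\<close> and \<open>q\<close> cannot be homogeneous,
  since otherwise both points would survive to the next layer. But if they are not homogeneous,
  a side of the older one meets the row or column of \<open>q\<close> or \<open>p\<close> within the box.
\<close>

section \<open>Rectangles, their sides, and merging\<close>

text \<open>\<open>Inf\<close> and \<open>Sup\<close> recover the sides from the bare point set. For
  a degenerate rectangle they coincide, so the set can have a single element.\<close>

definition vsides :: "point set \<Rightarrow> real set" where
  "vsides R = {Inf (fst ` R), Sup (fst ` R)}"

definition hsides :: "point set \<Rightarrow> real set" where
  "hsides R = {Inf (snd ` R), Sup (snd ` R)}"

definition grid :: "point set set \<Rightarrow> point set" where
  "grid F = (\<Union>R\<in>F. vsides R) \<times> (\<Union>R\<in>F. hsides R)"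

definition added :: "point set set \<Rightarrow> point set set \<Rightarrow> point set" where
  "added F G = grid F \<inter> \<Union>G"

lemma vsides_Times: "a \<le> b \<Longrightarrow> c \<le> d \<Longrightarrow> vsides ({a..b} \<times> {c..d}) = {a, b}"
  by (simp add: vsides_def)

lemma hsides_Times: "a \<le> b \<Longrightarrow> c \<le> d \<Longrightarrow> hsides ({a..b} \<times> {c..d}) = {c, d}"
  by (simp add: hsides_def)

lemma rectangle_Times_images:
  assumes "rectangle R"
  shows "R = fst ` R \<times> snd ` R"
  using assms by (auto simp: rectangle_def)

lemma rectangle_projections:
  assumes "rectangle R"
  shows "\<exists>a b. fst ` R = {a..b}" "\<exists>c d. snd ` R = {c..d}"
proof -
  obtain a b c d where "a \<le> b" "c \<le> d" "R = {a..b} \<times> {c..d}"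
    using assms unfolding rectangle_def by (elim exE conjE)
  then have "fst ` R = {a..b}" "snd ` R = {c..d}" by auto
  then show "\<exists>a b. fst ` R = {a..b}" "\<exists>c d. snd ` R = {c..d}" by blast+
qed

lemma mem_rectangle_iff:
  "rectangle R \<Longrightarrow> (x, y) \<in> R \<longleftrightarrow> x \<in> fst ` R \<and> y \<in> snd ` R"
  using rectangle_Times_images[of R] by (metis mem_Sigma_iff)

lemma rectangle_singleton: "rectangle {p}"
proof -
  have "{p} = {fst p..fst p} \<times> {snd p..snd p}"
    by (auto simp: prod_eq_iff)
  then show ?thesis unfolding rectangle_def by blast
qed

lemma grid_singletons: "grid ((\<lambda>p. {p}) ` P) \<inter> \<Union>((\<lambda>p. {p}) ` P) = P"
  by (force simp: grid_def vsides_def hsides_def)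

text \<open>Rectangles here are nonempty, hence not closed under intersection, so that the hull is a
  rectangle has to be shown by exhibiting it.\<close>

lemma bounding_box_Un:
  assumes "a \<le> b" "c \<le> d" "a' \<le> b'" "c' \<le> d'"
  shows "bounding_box ({a..b} \<times> {c..d} \<union> {a'..b'} \<times> {c'..d'}) =
    {min a a'..max b b'} \<times> {min c c'..max d d'}"
  unfolding bounding_box_def
proof (rule hull_unique)
  show "{a..b} \<times> {c..d} \<union> {a'..b'} \<times> {c'..d'} \<subseteq> {min a a'..max b b'} \<times> {min c c'..max d d'}"
    by auto
  show "rectangle ({min a a'..max b b'} \<times> {min c c'..max d d'})"
    unfolding rectangle_def
    by (intro exI conjI refl) (use assms in auto)
next
  fix U assume U: "{a..b} \<times> {c..d} \<union> {a'..b'} \<times> {c'..d'} \<subseteq> U" "rectangle U"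
  then obtain e f g h where U_eq: "U = {e..f} \<times> {g..h}"
    unfolding rectangle_def by blast
  \<comment> \<open>Since \<open>U\<close> is a product of intervals, these four corners already
    push its bounds past every minimum and maximum.\<close>
  have "(a, c) \<in> U" "(b, d) \<in> U" "(a', c') \<in> U" "(b', d') \<in> U"
    using assms U(1) by auto
  then show "{min a a'..max b b'} \<times> {min c c'..max d d'} \<subseteq> U"
    unfolding U_eq by auto
qed

lemma bounding_box_merge:
  assumes "rectangle S" "rectangle T"
  defines "Q \<equiv> bounding_box (S \<union> T)"
  shows "rectangle Q" "S \<subseteq> Q" "T \<subseteq> Q"
    "vsides Q \<subseteq> vsides S \<union> vsides T" "hsides Q \<subseteq> hsides S \<union> hsides T"
proof -
  obtain a b c d where S: "a \<le> b" "c \<le> d" "S = {a..b} \<times> {c..d}"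
    using assms(1) unfolding rectangle_def by blast
  obtain a' b' c' d' where T: "a' \<le> b'" "c' \<le> d'" "T = {a'..b'} \<times> {c'..d'}"
    using assms(2) unfolding rectangle_def by blast
  have Q: "Q = {min a a'..max b b'} \<times> {min c c'..max d d'}"
    unfolding Q_def S(3) T(3) by (rule bounding_box_Un) (use S T in auto)
  have le: "min a a' \<le> max b b'" "min c c' \<le> max d d'"
    using S T by auto
  show "rectangle Q"
    unfolding rectangle_def using Q le by blast
  show "S \<subseteq> Q" "T \<subseteq> Q"
    unfolding Q_def bounding_box_def using hull_subset[of "S \<union> T" rectangle] by auto
  show "vsides Q \<subseteq> vsides S \<union> vsides T"
    unfolding Q S(3) T(3) using S T le by (auto simp: vsides_Times min_def max_def)
  show "hsides Q \<subseteq> hsides S \<union> hsides T"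
    unfolding Q S(3) T(3) using S T le by (auto simp: hsides_Times min_def max_def)
qed

lemma merge_stepE:
  assumes "merge_step F G" "\<forall>R\<in>F. rectangle R"
  obtains S T Q where "S \<in> F" "T \<in> F" "rectangle Q" "S \<subseteq> Q" "T \<subseteq> Q"
    "vsides Q \<subseteq> vsides S \<union> vsides T" "hsides Q \<subseteq> hsides S \<union> hsides T"
    "G = insert Q (F - {S, T})"
proof -
  obtain S T where ST: "S \<in> F" "T \<in> F" "G = insert (bounding_box (S \<union> T)) (F - {S, T})"
    using assms(1) unfolding merge_step_def by blast
  then have "rectangle S" "rectangle T" using assms(2) by auto
  from that[OF ST(1,2) bounding_box_merge[OF this] ST(3)] show thesis .
qed

lemma merge_step_rectangles:
  assumes "merge_step F G" "\<forall>R\<in>F. rectangle R"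
  shows "\<forall>R\<in>G. rectangle R"
  using assms by (elim merge_stepE) auto

text \<open>Each side of the merged box extends a side of \<open>S\<close> or \<open>T\<close>, so
  merging creates no new coordinates.\<close>

lemma merge_step_grid_subset:
  assumes "merge_step F G" "\<forall>R\<in>F. rectangle R"
  shows "grid G \<subseteq> grid F"
proof -
  obtain S T Q where Q: "S \<in> F" "T \<in> F"
    "vsides Q \<subseteq> vsides S \<union> vsides T" "hsides Q \<subseteq> hsides S \<union> hsides T"
    "G = insert Q (F - {S, T})"
    using assms by (rule merge_stepE)
  then have "(\<Union>R\<in>G. vsides R) \<subseteq> (\<Union>R\<in>F. vsides R)" "(\<Union>R\<in>G. hsides R) \<subseteq> (\<Union>R\<in>F. hsides R)"
    by auto
  then show ?thesis
    unfolding grid_def by (rule Sigma_mono)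
qed

lemma merge_step_Union_subset:
  assumes "merge_step F G" "\<forall>R\<in>F. rectangle R"
  shows "\<Union>F \<subseteq> \<Union>G"
proof -
  obtain S T Q where "S \<subseteq> Q" "T \<subseteq> Q" "G = insert Q (F - {S, T})"
    using assms by (rule merge_stepE)
  then show ?thesis by auto
qed

text \<open>Used to see that of two distinct rectangles of \<open>G\<close> at least one already
  belongs to \<open>F\<close>.\<close>

lemma merge_step_new:
  assumes "merge_step F G"
  obtains Q where "G \<subseteq> insert Q F"
  using assms unfolding merge_step_def by blast


section \<open>The number of added points\<close>

lemma finite_red_edges: "finite F \<Longrightarrow> finite (red_edges F)"
  by (rule finite_subset[of _ "Pow F"]) (auto simp: red_edges_def)

lemma card_neighbours_le_max_degree:
  assumes "finite F" "Q \<in> F"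
  shows "card {U \<in> F. U \<noteq> Q \<and> \<not> homogeneous U Q} \<le> max_degree F (red_edges F)"
proof -
  let ?N = "{U \<in> F. U \<noteq> Q \<and> \<not> homogeneous U Q}"
  let ?E = "{e \<in> red_edges F. Q \<in> e}"
  have "card ?N \<le> card ?E"
  proof (rule card_inj_on_le)
    show "inj_on (\<lambda>U. {U, Q}) ?N"
      by (auto simp: inj_on_def doubleton_eq_iff)
    show "(\<lambda>U. {U, Q}) ` ?N \<subseteq> ?E"
      using assms by (auto simp: red_edges_def)
    show "finite ?E"
      using assms finite_red_edges by auto
  qed
  also have "\<dots> \<le> max_degree F (red_edges F)"
    unfolding max_degree_def using assms by (intro Max_ge) auto
  finally show ?thesis .
qed

lemma card_UN_doubletons_le:
  assumes "finite A" "\<And>x. x \<in> A \<Longrightarrow> card (f x) \<le> 2"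
  shows "card (\<Union>x\<in>A. f x) \<le> 2 * card A"
proof -
  have "card (\<Union>x\<in>A. f x) \<le> (\<Sum>x\<in>A. card (f x))"
    by (rule card_UN_le[OF assms(1)])
  also have "\<dots> \<le> 2 * card A"
    using sum_bounded_above[of A "\<lambda>x. card (f x)" 2] assms(2) by simp
  finally show ?thesis .
qed

lemma sides_finite_card:
  "finite (vsides R)" "finite (hsides R)" "card (vsides R) \<le> 2" "card (hsides R) \<le> 2"
  by (auto simp: vsides_def hsides_def card_insert_if)

lemma sides_subset:
  assumes "rectangle R"
  shows "vsides R \<subseteq> fst ` R" "hsides R \<subseteq> snd ` R"
  using assms by (auto simp: rectangle_def vsides_Times hsides_Times)

text \<open>Only \<open>D\<close> has to be paid for: along the sequence,
  \<open>grid F \<inter> \<Union>F\<close> is \<open>P\<close> for the first family and lies in the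
  previous layer for every later one.\<close>

lemma added_merge_step:
  assumes step: "merge_step F G" and rect: "\<forall>R\<in>F. rectangle R" and "finite F"
    and deg: "max_degree G (red_edges G) < d"
  obtains D where "added F G \<subseteq> (grid F \<inter> \<Union>F) \<union> D" "finite D" "card D \<le> (2 * (d + 1))\<^sup>2"
proof -
  obtain S T Q where Q: "S \<in> F" "T \<in> F" "rectangle Q"
    "vsides Q \<subseteq> vsides S \<union> vsides T" "hsides Q \<subseteq> hsides S \<union> hsides T"
    "G = insert Q (F - {S, T})"
    using step rect by (rule merge_stepE)
  define N where "N = {U \<in> G. U \<noteq> Q \<and> \<not> homogeneous U Q}"
  \<comment> \<open>At most \<open>d - 1\<close> red neighbours and two merged rectangles give
    \<open>d + 1\<close>. \<open>Q\<close> is not added separately, as its sides are sides of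
    \<open>S\<close> or \<open>T\<close>.\<close>
  define M where "M = N \<union> {S, T}"
  define D where "D = (\<Union>U\<in>M. vsides U) \<times> (\<Union>U\<in>M. hsides U)"
  have fin: "finite G" "finite M"
    unfolding M_def N_def using Q \<open>finite F\<close> by auto
  have "card N < d"
    using card_neighbours_le_max_degree[of G Q] deg fin Q(6) unfolding N_def by auto
  moreover have "card M \<le> card N + card {S, T}"
    unfolding M_def by (rule card_Un_le)
  moreover have "card {S, T} \<le> 2"
    by (simp add: card_insert_if)
  ultimately have "card M \<le> d + 1"
    by linarith
  then have "card (\<Union>U\<in>M. vsides U) \<le> 2 * (d + 1)" "card (\<Union>U\<in>M. hsides U) \<le> 2 * (d + 1)"
    using card_UN_doubletons_le[OF fin(2), of vsides] card_UN_doubletons_le[OF fin(2), of hsides]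
      sides_finite_card by force+
  then have "card D \<le> (2 * (d + 1))\<^sup>2"
    unfolding D_def card_cartesian_product power2_eq_square by (rule mult_le_mono)
  moreover have "finite D"
    unfolding D_def using fin sides_finite_card by auto
  moreover have "added F G \<subseteq> (grid F \<inter> \<Union>F) \<union> D"
  proof
    fix p assume "p \<in> added F G"
    then obtain U V where UV: "U \<in> F" "V \<in> F" "fst p \<in> vsides U" "snd p \<in> hsides V"
      "p \<in> grid F" "p \<in> \<Union>G"
      unfolding added_def grid_def by (cases p) auto
    show "p \<in> (grid F \<inter> \<Union>F) \<union> D"
    proof (cases "p \<in> \<Union>F")
      case False
      then have "p \<in> Q" using UV(6) Q(6) by auto
      have "fst p \<in> fst ` U \<inter> fst ` Q"
        using \<open>p \<in> Q\<close> UV sides_subset rect by blast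
      \<comment> \<open>The case \<open>U = Q\<close> remains because the merged box may coincide
        with a rectangle of \<open>F\<close>. Its sides are then covered by those of
        \<open>S\<close> and \<open>T\<close>.\<close>
      then have "U \<in> M \<or> U = Q"
        using UV(1) Q(6) unfolding M_def N_def homogeneous_def by blast
      then have "fst p \<in> (\<Union>U\<in>M. vsides U)"
        using UV(3) Q(4) unfolding M_def by blast
      moreover have "snd p \<in> snd ` V \<inter> snd ` Q"
        using \<open>p \<in> Q\<close> UV sides_subset rect by blast
      then have "V \<in> M \<or> V = Q"
        using UV(2) Q(6) unfolding M_def N_def homogeneous_def by blast
      then have "snd p \<in> (\<Union>U\<in>M. hsides U)"
        using UV(4) Q(5) unfolding M_def by blast
      ultimately show ?thesis
        unfolding D_def by (simp add: mem_Times_iff)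
    qed (use UV in simp)
  qed
  ultimately show thesis using that by blast
qed


section \<open>The added points form a satisfied set\<close>

lemma corner_rect_iff:
  "(x, y) \<in> corner_rect p q \<longleftrightarrow>
    x \<in> {min (fst p) (fst q)..max (fst p) (fst q)} \<and> y \<in> {min (snd p) (snd q)..max (snd p) (snd q)}"
  by (simp add: corner_rect_def)

lemma corner_rect_commute: "corner_rect p q = corner_rect q p"
  by (simp add: corner_rect_def min.commute max.commute)

text \<open>
  Working with the endpoint nearest to \<open>z\<close> makes a distinction between the four relative
  positions of \<open>p\<close> and \<open>q\<close> unnecessary.
\<close>
lemma nearest_endpoint:
  fixes x z :: real
  assumes "x \<in> {l..r}" "z \<notin> {l..r}"
  obtains e where "e \<in> {l, r}" "e \<in> {min x z..max x z}" "e \<noteq> z"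
    "\<And>l' r'. z \<in> {l'..r'} \<Longrightarrow> {l'..r'} \<inter> {l..r} \<noteq> {} \<Longrightarrow> e \<in> {l'..r'}"
proof (cases "z < l")
  case True
  with assms show ?thesis by (intro that[of l]) auto
next
  case False
  with assms show ?thesis by (intro that[of r]) auto
qed

text \<open>Applied with \<open>x\<close> the first coordinate of \<open>q\<close>: \<open>e\<close>
  then stays within the horizontal range of the box of \<open>p\<close> and \<open>q\<close>, and
  the last clause places it over a rectangle \<open>B\<close> around \<open>q\<close>.\<close>

lemma nearest_vside:
  assumes "rectangle A" "p \<in> A" "x \<notin> fst ` A"
  obtains e where "e \<in> vsides A" "e \<in> fst ` A" "e \<in> {min (fst p) x..max (fst p) x}" "e \<noteq> x"
    "\<And>B. rectangle B \<Longrightarrow> x \<in> fst ` B \<Longrightarrow> fst ` B \<inter> fst ` A \<noteq> {} \<Longrightarrow> e \<in> fst ` B"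
proof -
  obtain a b c d where A: "a \<le> b" "c \<le> d" "A = {a..b} \<times> {c..d}"
    using assms(1) unfolding rectangle_def by blast
  have fA: "fst ` A = {a..b}" using A by auto
  obtain e where e: "e \<in> {a, b}" "e \<in> {min (fst p) x..max (fst p) x}" "e \<noteq> x"
    "\<And>l r. x \<in> {l..r} \<Longrightarrow> {l..r} \<inter> {a..b} \<noteq> {} \<Longrightarrow> e \<in> {l..r}"
    using nearest_endpoint[of "fst p" a b x] assms(2,3) unfolding fA by (metis fA imageI)
  have "e \<in> fst ` B" if B: "rectangle B" "x \<in> fst ` B" "fst ` B \<inter> fst ` A \<noteq> {}" for B
  proof -
    obtain l r where "fst ` B = {l..r}"
      using rectangle_projections(1)[OF B(1)] by blast
    then show ?thesis using e(4)[of l r] B fA by simp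
  qed
  moreover have "e \<in> vsides A" "e \<in> fst ` A"
    using e(1) A(1,2) unfolding fA unfolding A(3) by (auto simp: vsides_Times)
  ultimately show thesis using that e(2,3) by blast
qed

lemma nearest_hside:
  assumes "rectangle A" "p \<in> A" "y \<notin> snd ` A"
  obtains e where "e \<in> hsides A" "e \<in> snd ` A" "e \<in> {min (snd p) y..max (snd p) y}" "e \<noteq> y"
    "\<And>B. rectangle B \<Longrightarrow> y \<in> snd ` B \<Longrightarrow> snd ` B \<inter> snd ` A \<noteq> {} \<Longrightarrow> e \<in> snd ` B"
proof -
  obtain a b c d where A: "a \<le> b" "c \<le> d" "A = {a..b} \<times> {c..d}"
    using assms(1) unfolding rectangle_def by blast
  have sA: "snd ` A = {c..d}" using A by auto
  obtain e where e: "e \<in> {c, d}" "e \<in> {min (snd p) y..max (snd p) y}" "e \<noteq> y"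
    "\<And>l r. y \<in> {l..r} \<Longrightarrow> {l..r} \<inter> {c..d} \<noteq> {} \<Longrightarrow> e \<in> {l..r}"
    using nearest_endpoint[of "snd p" c d y] assms(2,3) unfolding sA by (metis sA imageI)
  have "e \<in> snd ` B" if B: "rectangle B" "y \<in> snd ` B" "snd ` B \<inter> snd ` A \<noteq> {}" for B
  proof -
    obtain l r where "snd ` B = {l..r}"
      using rectangle_projections(2)[OF B(1)] by blast
    then show ?thesis using e(4)[of l r] B sA by simp
  qed
  moreover have "e \<in> hsides A" "e \<in> snd ` A"
    using e(1) A(1,2) unfolding sA unfolding A(3) by (auto simp: hsides_Times)
  ultimately show thesis using that e(2,3) by blast
qed

lemma gridI: "A \<in> F \<Longrightarrow> e \<in> vsides A \<Longrightarrow> B \<in> F \<Longrightarrow> f \<in> hsides B \<Longrightarrow> (e, f) \<in> grid F"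
  by (auto simp: grid_def)

lemma grid_exchange: "p \<in> grid F \<Longrightarrow> q \<in> grid F \<Longrightarrow> (fst p, snd q) \<in> grid F"
  by (auto simp: grid_def)

text \<open>The negation of the condition that \<open>satisfied\<close> imposes on a single
  pair.\<close>

definition separated :: "point set \<Rightarrow> point \<Rightarrow> point \<Rightarrow> bool" where
  "separated S p q \<longleftrightarrow>
     fst p \<noteq> fst q \<and> snd p \<noteq> snd q \<and> corner_rect p q \<inter> (S - {p, q}) = {}"

lemma separated_commute: "separated S p q \<longleftrightarrow> separated S q p"
  by (auto simp: separated_def corner_rect_commute insert_commute)

lemma separatedD:
  assumes "separated S p q" "(x, y) \<in> S"
    "x \<in> {min (fst p) (fst q)..max (fst p) (fst q)}" "y \<in> {min (snd p) (snd q)..max (snd p) (snd q)}"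
  shows "(x, y) = p \<or> (x, y) = q"
proof -
  have "(x, y) \<in> corner_rect p q"
    unfolding corner_rect_iff using assms by blast
  then show ?thesis
    using assms(1,2) unfolding separated_def by blast
qed

text \<open>The corner \<open>(e, f)\<close> of \<open>A\<close> nearest to \<open>q\<close> lies in
  the box and in \<open>S\<close>. It avoids the column of \<open>q\<close>, so it can only be
  \<open>p\<close>.\<close>

lemma separated_corner:
  assumes sep: "separated S p q" and A: "rectangle A" "A \<in> F" "p \<in> A" "grid F \<inter> A \<subseteq> S"
    and q: "fst q \<notin> fst ` A" "snd q \<notin> snd ` A"
  shows "p \<in> grid F"
proof -
  obtain e where e: "e \<in> vsides A" "e \<in> fst ` A" "e \<in> {min (fst p) (fst q)..max (fst p) (fst q)}"
    "e \<noteq> fst q"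
    using nearest_vside[OF A(1,3) q(1)] by metis
  obtain f where f: "f \<in> hsides A" "f \<in> snd ` A" "f \<in> {min (snd p) (snd q)..max (snd p) (snd q)}"
    "f \<noteq> snd q"
    using nearest_hside[OF A(1,3) q(2)] by metis
  have "(e, f) \<in> grid F" using A(2) e(1) f(1) by (rule gridI[OF _ _ A(2)])
  moreover have "(e, f) \<in> A" using mem_rectangle_iff[OF A(1)] e f by blast
  ultimately have "(e, f) = p \<or> (e, f) = q"
    using separatedD[OF sep _ e(3) f(3)] A(4) by blast
  with \<open>(e, f) \<in> grid F\<close> e(4) show ?thesis by auto
qed

text \<open>Once \<open>q\<close> lies on the grid, \<open>q \<notin> A\<close> is enough for
  \<open>separated_corner\<close>. If \<open>A\<close> met the column of \<open>q\<close>, the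
  horizontal side of \<open>A\<close> nearest to \<open>q\<close> would cross that column in a third
  point of the box; rows are treated likewise.\<close>

lemma separated_corner_or_side:
  assumes sep: "separated S p q" and A: "rectangle A" "A \<in> F" "p \<in> A" "grid F \<inter> A \<subseteq> S"
    and q: "q \<in> grid F" "q \<notin> A"
  shows "p \<in> grid F" "fst q \<notin> fst ` A" "snd q \<notin> snd ` A"
proof -
  have ne: "fst p \<noteq> fst q" "snd p \<noteq> snd q"
    using sep by (auto simp: separated_def)
  have qA: "fst q \<notin> fst ` A \<or> snd q \<notin> snd ` A"
    using q(2) mem_rectangle_iff[OF A(1), of "fst q" "snd q"] by simp
  obtain U V where UV: "U \<in> F" "V \<in> F" "fst q \<in> vsides U" "snd q \<in> hsides V"
    using q(1) unfolding grid_def by (cases q) auto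
  show x: "fst q \<notin> fst ` A"
  proof
    assume x: "fst q \<in> fst ` A"
    then have "snd q \<notin> snd ` A" using qA by blast
    then obtain f where f: "f \<in> hsides A" "f \<in> snd ` A" "f \<noteq> snd q"
      "f \<in> {min (snd p) (snd q)..max (snd p) (snd q)}"
      using nearest_hside[OF A(1,3)] by metis
    have "(fst q, f) \<in> grid F \<inter> A"
      using gridI[OF UV(1,3) A(2) f(1)] mem_rectangle_iff[OF A(1)] x f by blast
    then have "(fst q, f) = p \<or> (fst q, f) = q"
      using separatedD[OF sep _ _ f(4), of "fst q"] A(4) by fastforce
    then show False using ne f(3) by (metis fst_conv snd_conv)
  qed
  show y: "snd q \<notin> snd ` A"
  proof
    assume y: "snd q \<in> snd ` A"
    then obtain e where e: "e \<in> vsides A" "e \<in> fst ` A" "e \<noteq> fst q"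
      "e \<in> {min (fst p) (fst q)..max (fst p) (fst q)}"
      using nearest_vside[OF A(1,3)] x by metis
    have "(e, snd q) \<in> grid F \<inter> A"
      using gridI[OF A(2) e(1) UV(2,4)] mem_rectangle_iff[OF A(1)] y e by blast
    then have "(e, snd q) = p \<or> (e, snd q) = q"
      using separatedD[OF sep _ e(4), of "snd q"] A(4) by fastforce
    then show False using ne e(3) by (metis fst_conv snd_conv)
  qed
  show "p \<in> grid F"
    by (rule separated_corner[OF sep A x y])
qed

text \<open>\<open>A\<close> is an old rectangle that survives the merge, while \<open>B\<close> may
  be the new one. Being in \<open>F\<close>, \<open>A\<close> contributes its sides to
  \<open>grid F\<close>; if the projections met, its side nearest to \<open>q\<close> would cross
  the row or column of \<open>q\<close> inside \<open>B\<close>, giving a third point of the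
  box.\<close>

lemma separated_homogeneous:
  assumes sep: "separated S p q" and pq: "p \<in> grid F" "q \<in> grid F"
    and S: "added F G \<subseteq> S"
    and A: "rectangle A" "A \<in> F" "A \<in> G" "p \<in> A" "q \<notin> A"
    and B: "rectangle B" "B \<in> G" "q \<in> B"
  shows "homogeneous A B"
proof -
  have ne: "fst p \<noteq> fst q" "snd p \<noteq> snd q"
    using sep by (auto simp: separated_def)
  have sub: "grid F \<inter> A \<subseteq> S"
    using S A(3) unfolding added_def by blast
  note out = separated_corner_or_side(2,3)[OF sep A(1,2,4) sub pq(2) A(5)]
  have qB: "fst q \<in> fst ` B" "snd q \<in> snd ` B"
    using B(3) by auto
  obtain U V where UV: "U \<in> F" "V \<in> F" "fst q \<in> vsides U" "snd q \<in> hsides V"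
    using pq(2) unfolding grid_def by (cases q) auto
  have "fst ` B \<inter> fst ` A = {}"
  proof (rule ccontr)
    assume "fst ` B \<inter> fst ` A \<noteq> {}"
    then obtain e where e: "e \<in> vsides A" "e \<noteq> fst q" "e \<in> fst ` B"
      "e \<in> {min (fst p) (fst q)..max (fst p) (fst q)}"
      using nearest_vside[OF A(1,4) out(1)] B(1) qB(1) by metis
    have "(e, snd q) \<in> grid F \<inter> B"
      using gridI[OF A(2) e(1) UV(2,4)] mem_rectangle_iff[OF B(1)] qB e by blast
    then have "(e, snd q) = p \<or> (e, snd q) = q"
      using separatedD[OF sep _ e(4), of "snd q"] S B(2) unfolding added_def by fastforce
    then show False using ne e(2) by (metis fst_conv snd_conv)
  qed
  moreover have "snd ` B \<inter> snd ` A = {}"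
  proof (rule ccontr)
    assume "snd ` B \<inter> snd ` A \<noteq> {}"
    then obtain f where f: "f \<in> hsides A" "f \<noteq> snd q" "f \<in> snd ` B"
      "f \<in> {min (snd p) (snd q)..max (snd p) (snd q)}"
      using nearest_hside[OF A(1,4) out(2)] B(1) qB(2) by metis
    have "(fst q, f) \<in> grid F \<inter> B"
      using gridI[OF UV(1,3) A(2) f(1)] mem_rectangle_iff[OF B(1)] qB f by blast
    then have "(fst q, f) = p \<or> (fst q, f) = q"
      using separatedD[OF sep _ _ f(4), of "fst q"] S B(2) unfolding added_def by fastforce
    then show False using ne f(2) by (metis fst_conv snd_conv)
  qed
  ultimately show ?thesis
    unfolding homogeneous_def by blast
qed

lemma homogeneous_commute: "homogeneous A B \<longleftrightarrow> homogeneous B A"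
  by (auto simp: homogeneous_def)

text \<open>A common rectangle would contain the box corner \<open>(fst p, snd q)\<close>, a grid
  point and hence a point of \<open>S\<close>. So \<open>A\<close> and \<open>B\<close> differ, one
  of them is old, and \<open>separated_homogeneous\<close> applies up to exchanging the roles of
  \<open>p\<close> and \<open>q\<close>.\<close>

lemma separated_added:
  assumes sep: "separated S p q" and S: "added F G \<subseteq> S"
    and step: "merge_step F G" and rect: "\<forall>R\<in>F. rectangle R"
    and A: "p \<in> grid F" "p \<in> A" "A \<in> G" and B: "q \<in> grid F" "q \<in> B" "B \<in> G"
  shows "homogeneous A B"
proof -
  have ne: "fst p \<noteq> fst q" "snd p \<noteq> snd q"
    using sep by (auto simp: separated_def)
  have rectG: "rectangle C" if "C \<in> G" for C
    using merge_step_rectangles[OF step rect] that by blast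
  have no_common: False if "C \<in> G" "p \<in> C" "q \<in> C" for C
  proof -
    have "(fst p, snd q) \<in> C"
      using mem_rectangle_iff[OF rectG[OF that(1)]] that by auto
    then have "(fst p, snd q) \<in> S"
      using grid_exchange[OF A(1) B(1)] S that(1) unfolding added_def by blast
    then have "(fst p, snd q) = p \<or> (fst p, snd q) = q"
      using separatedD[OF sep] by simp
    then show False using ne by (metis fst_conv snd_conv)
  qed
  have out: "q \<notin> A" "p \<notin> B"
    using no_common A B by auto
  obtain Q where "G \<subseteq> insert Q F"
    using merge_step_new[OF step] by blast
  moreover have "A \<noteq> B" using A(2) out(2) by blast
  ultimately have "A \<in> F \<or> B \<in> F"
    using A(3) B(3) by blast
  then show ?thesis
  proof
    assume "A \<in> F"
    show ?thesis
      by (rule separated_homogeneous[OF sep A(1) B(1) S rectG[OF A(3)] \<open>A \<in> F\<close> A(3,2) out(1)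
            rectG[OF B(3)] B(3,2)])
  next
    assume "B \<in> F"
    have "homogeneous B A"
      by (rule separated_homogeneous[OF _ B(1) A(1) S rectG[OF B(3)] \<open>B \<in> F\<close> B(3,2) out(2)
            rectG[OF A(3)] A(3,2)]) (use sep separated_commute in blast)
    then show ?thesis using homogeneous_commute by blast
  qed
qed

section \<open>The layers of a fixed merge sequence and the resulting bound on
  \<open>OPT\<close>\<close>

locale merging =
  fixes F :: "nat \<Rightarrow> point set set" and n :: nat and P :: "point set"
  assumes finite_P: "finite P" and n: "n = card P"
    and seq: "merge_sequence P F"
begin

lemma merge_step_at: "i \<in> {1..<n} \<Longrightarrow> merge_step (F i) (F (Suc i))"
  using seq n unfolding merge_sequence_def by blast

lemma finite_rectangles:
  assumes "1 \<le> i" "i \<le> n"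
  shows "finite (F i) \<and> (\<forall>R\<in>F i. rectangle R)"
  using assms
proof (induction i rule: dec_induct)
  case base
  then show ?case
    using seq finite_P unfolding merge_sequence_def by (auto simp: rectangle_singleton)
next
  case (step i)
  then have "merge_step (F i) (F (Suc i))" using merge_step_at by simp
  moreover have "finite (F i)" "\<forall>R\<in>F i. rectangle R" using step by auto
  ultimately show ?case
    using merge_step_rectangles merge_step_new finite_subset by (metis finite_insert)
qed

lemma rect: "1 \<le> i \<Longrightarrow> i \<le> n \<Longrightarrow> \<forall>R\<in>F i. rectangle R"
  using finite_rectangles by blast

lemma grid_antimono:
  assumes "1 \<le> i" "i \<le> j" "j \<le> n"
  shows "grid (F j) \<subseteq> grid (F i)"
  using assms(2,3)
proof (induction j rule: dec_induct)
  case (step j)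
  then show ?case
    using merge_step_grid_subset[OF merge_step_at rect, of j] assms(1) by auto
qed simp

lemma Union_mono:
  assumes "1 \<le> i" "i \<le> j" "j \<le> n"
  shows "\<Union>(F i) \<subseteq> \<Union>(F j)"
  using assms(2,3)
proof (induction j rule: dec_induct)
  case (step j)
  then show ?case
    using merge_step_Union_subset[OF merge_step_at rect, of j] assms(1) by (meson atLeastLessThan_iff
      le_trans less_le_trans less_or_eq_imp_le order_trans Suc_le_lessD)
qed simp

definition layer :: "nat \<Rightarrow> point set" where
  "layer i = added (F i) (F (Suc i))"

text \<open>For \<open>n > 1\<close> the first layer already contains \<open>P\<close>; the explicit
  \<open>P\<close> covers the case of a single point, where there are no layers.\<close>

definition solution :: "point set" where
  "solution = P \<union> (\<Union>i\<in>{1..<n}. layer i)"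

lemma P_eq: "grid (F 1) \<inter> \<Union>(F 1) = P"
  using seq grid_singletons unfolding merge_sequence_def by simp

lemma grid_Union_subset_layer:
  assumes "i \<in> {1..<n}"
  shows "grid (F i) \<inter> \<Union>(F i) \<subseteq> layer i"
  using Union_mono[of i "Suc i"] assms unfolding layer_def added_def by auto

lemma layer_subset_solution: "i \<in> {1..<n} \<Longrightarrow> layer i \<subseteq> solution"
  unfolding solution_def by blast

lemma P_subset_layer: "1 < n \<Longrightarrow> P \<subseteq> layer 1"
  using grid_Union_subset_layer[of 1] P_eq by simp

lemma separated_not_same_layer:
  assumes sep: "separated solution p q"
  shows "\<not> (i \<in> {1..<n} \<and> p \<in> layer i \<and> q \<in> layer i)"
proof
  define K where "K = {i \<in> {1..<n}. p \<in> layer i \<and> q \<in> layer i}"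
  assume "i \<in> {1..<n} \<and> p \<in> layer i \<and> q \<in> layer i"
  then have "K \<noteq> {}" "finite K" unfolding K_def by auto
  define k where "k = Max K"
  have "k \<in> K" using \<open>K \<noteq> {}\<close> \<open>finite K\<close> k_def by simp
  then have k: "k \<in> {1..<n}" "p \<in> layer k" "q \<in> layer k"
    unfolding K_def by auto
  have kmax: "Suc k \<notin> K" using Max_ge[OF \<open>finite K\<close>, of "Suc k"] k_def by auto
  obtain A B where A: "p \<in> grid (F k)" "p \<in> A" "A \<in> F (Suc k)"
    and B: "q \<in> grid (F k)" "q \<in> B" "B \<in> F (Suc k)"
    using k unfolding layer_def added_def by blast
  have hom: "homogeneous A B"
    by (rule separated_added[OF sep _ merge_step_at[OF k(1)] rect A B])
      (use k layer_subset_solution layer_def in auto)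
  then have "A \<noteq> B" using A(2) by (auto simp: homogeneous_def)
  \<comment> \<open>The final family has only one rectangle, so two distinct ones show that another
    layer follows.\<close>
  have "Suc k \<noteq> n"
  proof
    assume "Suc k = n"
    then obtain R where "F (Suc k) = {R}"
      using seq n unfolding merge_sequence_def by auto
    then show False using A B \<open>A \<noteq> B\<close> by auto
  qed
  then have k': "Suc k \<in> {1..<n}" using k(1) by auto
  have sub: "grid (F (Suc k)) \<inter> \<Union>(F (Suc k)) \<subseteq> solution"
    using grid_Union_subset_layer[OF k'] layer_subset_solution[OF k'] by blast
  have sep': "separated solution q p"
    using sep separated_commute by blast
  have rA: "rectangle A" and rB: "rectangle B"
    using rect[of "Suc k"] k' A B by auto
  \<comment> \<open>Homogeneity means that \<open>A\<close> misses both coordinates of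
    \<open>q\<close>, and \<open>B\<close> both coordinates of \<open>p\<close>; so both points
    survive, against the maximality of \<open>k\<close>.\<close>
  have "p \<in> grid (F (Suc k))"
    by (rule separated_corner[OF sep rA A(3,2)]) (use sub hom A B in \<open>auto simp: homogeneous_def\<close>)
  moreover have "q \<in> grid (F (Suc k))"
    by (rule separated_corner[OF sep' rB B(3,2)]) (use sub hom A B in \<open>auto simp: homogeneous_def\<close>)
  ultimately have "p \<in> layer (Suc k)" "q \<in> layer (Suc k)"
    using grid_Union_subset_layer[OF k'] A B by blast+
  then show False using kmax k' unfolding K_def by blast
qed

lemma separated_not_layers:
  assumes sep: "separated solution p q" and "1 \<le> i" "i \<le> j" "j < n"
    "p \<in> layer i" "q \<in> layer j"
  shows False
proof -
  \<comment> \<open>Going from layer \<open>i\<close> to the first layer \<open>k\<close> that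
    contains \<open>q\<close>, the aim is to show that \<open>p\<close> survives up to
    \<open>k\<close>.\<close>
  define k where "k = (LEAST k. i \<le> k \<and> q \<in> layer k)"
  have k: "i \<le> k" "q \<in> layer k"
    using LeastI[of "\<lambda>k. i \<le> k \<and> q \<in> layer k" j] assms unfolding k_def by auto
  have "k \<le> j" unfolding k_def using assms by (intro Least_le) auto
  have kmin: "q \<notin> layer l" if "i \<le> l" "l < k" for l
    using not_less_Least[of l "\<lambda>k. i \<le> k \<and> q \<in> layer k"] that unfolding k_def by blast
  have kn: "k \<in> {1..<n}" using k assms \<open>k \<le> j\<close> by auto
  show False
  proof (cases "k = i")
    case True
    then show ?thesis using separated_not_same_layer[OF sep] k kn assms by blast
  next
    case False
    then have "i < k" using k by simp
    then obtain l where l: "k = Suc l" "i \<le> l" by (cases k) auto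
    have qg: "q \<in> grid (F k)" using k unfolding layer_def added_def by blast
    have "p \<in> \<Union>(F (Suc i))" using assms unfolding layer_def added_def by blast
    then have "p \<in> \<Union>(F k)" using Union_mono[of "Suc i" k] kn \<open>i < k\<close> by auto
    then obtain A where A: "A \<in> F k" "p \<in> A" by blast
    \<comment> \<open>Otherwise \<open>q\<close> would be covered by \<open>F (Suc l)\<close> and
      lie on the finer grid of \<open>F l\<close>, hence belong to layer \<open>l\<close>, before
      the least index \<open>k\<close>.\<close>
    have "q \<notin> A"
    proof
      assume "q \<in> A"
      then have "q \<in> layer l"
        using A qg grid_antimono[of l k] l assms kn unfolding layer_def added_def by auto
      then show False using kmin l by auto
    qed
    have sub: "grid (F k) \<inter> \<Union>(F k) \<subseteq> solution"
      using grid_Union_subset_layer[OF kn] layer_subset_solution[OF kn] by blast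
    have "p \<in> grid (F k)"
      by (rule separated_corner_or_side(1)[OF sep _ A _ qg \<open>q \<notin> A\<close>])
        (use rect[of k] kn A sub in auto)
    then have "p \<in> layer k" using grid_Union_subset_layer[OF kn] A by blast
    then show False using separated_not_same_layer[OF sep] k kn by blast
  qed
qed

lemma satisfied_solution: "satisfied solution"
proof (rule ccontr)
  assume "\<not> satisfied solution"
  then obtain p q where pq: "p \<in> solution" "q \<in> solution" and sep: "separated solution p q"
    unfolding satisfied_def separated_def by (auto simp only: ball_simps bex_simps de_Morgan_disj not_not)
  show False
  proof (cases "1 < n")
    case True
    then have "solution = (\<Union>i\<in>{1..<n}. layer i)"
      unfolding solution_def using P_subset_layer by force
    then obtain i j where "i \<in> {1..<n}" "j \<in> {1..<n}" "p \<in> layer i" "q \<in> layer j"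
      using pq by blast
    then show False
      using separated_not_layers[of p q i j] separated_not_layers[of q p j i] sep
        separated_commute[of solution p q] by (cases "i \<le> j") auto
  next
    case False
    then have "solution = P" unfolding solution_def by simp
    moreover have "card P \<le> 1" using False n by simp
    ultimately have "p = q" using pq finite_P card_le_Suc0_iff_eq by auto
    then show False using sep by (simp add: separated_def)
  qed
qed

lemma solution_bound:
  assumes "wide d P F"
  shows "finite solution" "card solution \<le> n + (n - 1) * (2 * (d + 1))\<^sup>2"
proof -
  have "\<exists>D. layer i \<subseteq> (grid (F i) \<inter> \<Union>(F i)) \<union> D \<and> finite D \<and> card D \<le> (2 * (d + 1))\<^sup>2"
    if i: "i \<in> {1..<n}" for i
  proof -
    have "max_degree (F (Suc i)) (red_edges (F (Suc i))) < d"
      using assms i n unfolding wide_def by auto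
    then show ?thesis
      using added_merge_step[OF merge_step_at[OF i], of d] finite_rectangles[of i] i
      unfolding layer_def by (metis atLeastLessThan_iff less_imp_le)
  qed
  then obtain D where D: "\<And>i. i \<in> {1..<n} \<Longrightarrow> layer i \<subseteq> (grid (F i) \<inter> \<Union>(F i)) \<union> D i"
    "\<And>i. i \<in> {1..<n} \<Longrightarrow> finite (D i)" "\<And>i. i \<in> {1..<n} \<Longrightarrow> card (D i) \<le> (2 * (d + 1))\<^sup>2"
    by metis
  let ?U = "P \<union> (\<Union>i\<in>{1..<n}. D i)"
  \<comment> \<open>Layer \<open>i + 1\<close> exceeds layer \<open>i\<close> by at most
    \<open>D (i + 1)\<close>, and the first layer exceeds \<open>P\<close> by at most
    \<open>D 1\<close>, so the sizes add up instead of multiplying.\<close>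
  have "1 \<le> i \<Longrightarrow> i < n \<Longrightarrow> layer i \<subseteq> ?U" for i
  proof (induction i rule: dec_induct)
    case base
    then show ?case using D(1)[of 1] P_eq by auto
  next
    case (step i)
    have old: "grid (F (Suc i)) \<inter> \<Union>(F (Suc i)) \<subseteq> layer i"
      using grid_antimono[of i "Suc i"] step unfolding layer_def added_def by auto
    have "layer (Suc i) \<subseteq> (grid (F (Suc i)) \<inter> \<Union>(F (Suc i))) \<union> D (Suc i)"
      using D(1) step by auto
    also have "\<dots> \<subseteq> layer i \<union> D (Suc i)"
      by (rule Un_mono[OF old subset_refl])
    also have "\<dots> \<subseteq> ?U"
    proof (rule Un_least)
      show "layer i \<subseteq> ?U" using step by simp
      show "D (Suc i) \<subseteq> ?U" using step by auto
    qed
    finally show ?case .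
  qed
  then have "(\<Union>i\<in>{1..<n}. layer i) \<subseteq> ?U" by (intro UN_least) simp
  then have sub: "solution \<subseteq> ?U" unfolding solution_def by simp
  have fin: "finite ?U" using finite_P D(2) by auto
  show "finite solution" using finite_subset[OF sub fin] .
  have "card solution \<le> card ?U" using card_mono[OF fin sub] .
  also have "\<dots> \<le> card P + card (\<Union>i\<in>{1..<n}. D i)" by (rule card_Un_le)
  also have "card (\<Union>i\<in>{1..<n}. D i) \<le> (\<Sum>i\<in>{1..<n}. card (D i))"
    by (rule card_UN_le) simp
  also have "\<dots> \<le> (n - 1) * (2 * (d + 1))\<^sup>2"
    using sum_bounded_above[of "{1..<n}" "\<lambda>i. card (D i)"] D(3) by simp
  finally show "card solution \<le> n + (n - 1) * (2 * (d + 1))\<^sup>2" using n by simp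
qed

lemma OPT_le:
  assumes "wide d P F"
  shows "OPT P \<le> n + (n - 1) * (2 * (d + 1))\<^sup>2"
proof -
  have "OPT P \<le> card solution"
    unfolding OPT_def
    by (rule Least_le) (use solution_bound(1)[OF assms] satisfied_solution solution_def in blast)
  then show ?thesis using solution_bound(2)[OF assms] by linarith
qed

end


section \<open>Existence of merge sequences\<close>

text \<open>Exactly the same rectangles contain the two unions, and the hull depends on nothing
  else.\<close>

lemma bounding_box_Un_absorb: "bounding_box (bounding_box X \<union> Y) = bounding_box (X \<union> Y)"
proof -
  have "bounding_box X \<union> Y \<subseteq> R \<longleftrightarrow> X \<union> Y \<subseteq> R" if "rectangle R" for R
    using that hull_subset[of X rectangle] hull_minimal[of X R rectangle]
    unfolding bounding_box_def by (meson Un_subset_iff subset_trans)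
  then show ?thesis
    unfolding bounding_box_def[of "_ \<union> Y"] hull_def by (metis (mono_tags, lifting))
qed

lemma bounding_box_singleton: "bounding_box {p} = {p}"
  unfolding bounding_box_def by (rule hull_same) (rule rectangle_singleton)

lemma subset_bounding_box: "X \<subseteq> bounding_box X"
  unfolding bounding_box_def by (rule hull_subset)

text \<open>Needed so that the \<open>LEAST\<close> in \<open>twin_width\<close> ranges over a
  nonempty set and is attained.\<close>

lemma merge_sequence_exists:
  assumes "finite P" "P \<noteq> {}"
  shows "\<exists>F. merge_sequence P F"
proof -
  obtain ps where ps: "set ps = P" "distinct ps"
    using finite_distinct_list[OF assms(1)] by blast
  have len: "length ps = card P" using ps distinct_card by force
  then have "ps \<noteq> []" using ps assms by auto
  \<comment> \<open>One box absorbs the points of \<open>P\<close> one after the other, in an arbitrary order.\<close>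
  define F where
    "F i = insert (bounding_box (set (take i ps))) ((\<lambda>p. {p}) ` set (drop i ps))" for i
  have "F 1 = (\<lambda>p. {p}) ` P"
    using ps(1) \<open>ps \<noteq> []\<close> by (cases ps) (auto simp: F_def bounding_box_singleton)
  moreover have "F (card P) = {bounding_box P}"
    using ps len unfolding F_def by simp
  moreover have "merge_step (F i) (F (Suc i))" if i: "i \<in> {1..<card P}" for i
  proof -
    let ?p = "ps ! i"
    let ?S = "bounding_box (set (take i ps))"
    have il: "i < length ps" using i len by simp
    have drop: "drop i ps = ?p # drop (Suc i) ps" by (rule Cons_nth_drop_Suc[OF il, symmetric])
    have take: "set (take (Suc i) ps) = set (take i ps) \<union> {?p}"
      using il by (simp add: take_Suc_conv_app_nth)
    have disj: "set (take i ps) \<inter> set (drop i ps) = {}"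
      using ps(2) by (simp add: set_take_disj_set_drop_if_distinct)
    have "hd ps \<in> set (take i ps)"
      using i \<open>ps \<noteq> []\<close> by (cases ps; cases i) auto
    then have hd: "hd ps \<in> ?S" "hd ps \<notin> set (drop i ps)"
      using subsetD[OF subset_bounding_box[of "set (take i ps)"], of "hd ps"] disj by auto
    \<comment> \<open>Families are sets, so removing \<open>?S\<close> must not delete a singleton
      still waiting to be merged. The box may contain \<open>p\<close>, but it also contains
      \<open>hd ps\<close>, which is already absorbed.\<close>
    have "?S \<noteq> {p}" if "p \<in> set (drop i ps)" for p
      using hd that by (metis singletonD)
    moreover have "?p \<notin> set (drop (Suc i) ps)"
      using distinct_drop[OF ps(2), of i] unfolding drop by simp
    ultimately have "F i - {?S, {?p}} = (\<lambda>p. {p}) ` set (drop (Suc i) ps)"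
      unfolding F_def drop by auto
    then have eq: "F (Suc i) = insert (bounding_box (?S \<union> {?p})) (F i - {?S, {?p}})"
      unfolding F_def[of "Suc i"] bounding_box_Un_absorb take by simp
    have ne: "?S \<noteq> {?p}" using hd drop by (metis list.set_intros(1) singletonD)
    have mem: "?S \<in> F i" "{?p} \<in> F i" unfolding F_def drop by auto
    show ?thesis
      unfolding merge_step_def by (rule bexI[OF _ mem(1)], rule bexI[OF _ mem(2)], rule conjI[OF ne eq])
  qed
  ultimately have "merge_sequence P F" unfolding merge_sequence_def by simp
  then show ?thesis by (rule exI[where x = F])
qed

lemma twin_width_attained:
  assumes "finite P" "P \<noteq> {}"
  obtains F where "merge_sequence P F" "wide (twin_width P) P F"
proof -
  obtain F where F: "merge_sequence P F"
    using merge_sequence_exists[OF assms] by blast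
  \<comment> \<open>A crude bound: the sum dominates every single degree, and \<open>Suc\<close>
    makes the inequality strict.\<close>
  define d where "d = Suc (\<Sum>i\<in>{1..card P}. max_degree (F i) (red_edges (F i)))"
  have "wide d P F"
    unfolding wide_def d_def
    by (auto simp: less_Suc_eq_le intro!: member_le_sum)
  with F have "\<exists>d F. merge_sequence P F \<and> wide d P F" by blast
  from LeastI_ex[OF this] have "\<exists>F. merge_sequence P F \<and> wide (twin_width P) P F"
    unfolding twin_width_def .
  then obtain G where "merge_sequence P G" "wide (twin_width P) P G"
    by (elim exE conjE)
  then show thesis by (rule that)
qed

theorem theorem3p2:
  "\<exists>C::real. C > 0 \<and>
     (\<forall>(P :: (real \<times> real) set) (n::nat) (d::nat).
        finite P \<longrightarrow> card P = n \<longrightarrow> general_position P \<longrightarrow> twin_width P = d \<longrightarrow>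
        real (OPT P) \<le> C * real n * (real d)\<^sup>2)"
proof (rule exI[of _ 17], intro conjI allI impI)
  fix P :: "point set" and n d :: nat
  assume P: "finite P" "card P = n" "twin_width P = d"
  show "real (OPT P) \<le> 17 * real n * (real d)\<^sup>2"
  proof (cases "P = {}")
    case True
    have "OPT P \<le> card ({} :: point set)"
      unfolding OPT_def
      by (rule Least_le, rule exI[where x = "{}"]) (simp add: True satisfied_def)
    then show ?thesis by simp
  next
    case False
    obtain F where F: "merge_sequence P F" "wide d P F"
      using twin_width_attained[OF P(1) False] unfolding P(3) .
    have n: "n > 0" using False P by (simp add: card_gt_0_iff flip: P(2))
    then have "max_degree (F 1) (red_edges (F 1)) < d"
      using F(2) P(2) unfolding wide_def by simp
    then have d: "d \<ge> 1" by simp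
    interpret merging F n P
      by (rule merging.intro[OF P(1) P(2)[symmetric] F(1)])
    \<comment> \<open>From \<open>d \<ge> 1\<close>, which the strict degree bound provides,
      \<open>2 * (d + 1) \<le> 4 * d\<close>. The constant 17 is 16 from this square plus 1 for the
      \<open>n\<close> points of \<open>P\<close>.\<close>
    have "(2 * (d + 1))\<^sup>2 \<le> (4 * d)\<^sup>2" using d by (intro power_mono) auto
    then have "(n - 1) * (2 * (d + 1))\<^sup>2 \<le> n * (4 * d)\<^sup>2" by (intro mult_le_mono) auto
    moreover have "n \<le> n * d\<^sup>2" using d by simp
    ultimately have "OPT P \<le> n * d\<^sup>2 + n * (4 * d)\<^sup>2"
      using OPT_le[OF F(2)] by linarith
    also have "\<dots> = 17 * n * d\<^sup>2" by (simp add: power_mult_distrib)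
    finally have "real (OPT P) \<le> real (17 * n * d\<^sup>2)" by (rule of_nat_mono)
    then show ?thesis by simp
  qed
qed simp

end
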